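(* Let $W_1(\mathbf x)=\omega_1(\rho),\dots,W_r(\mathbf x)=\omega_r(\rho)$ be radial weights. Let $\vec n=(n_1,\dots,n_r),\ \vec j=(j_1,\dots,j_r)\in\mathbb N_0^r$ be such that $0\le|\vec j|\le|\vec n|/2$, and consider the polynomials $$\mathbf P^{\vec n}_{\vec j,\nu}(\mathbf x)=p_{2\vec j}^{(2|\vec n|-4|\vec j|)}(\rho)\,Y_\nu^{|\vec n|-2|\vec j|}(\mathbf x),\qquad \nu=1,\dots,\dim\mathbb H^d_{|\vec n|-2|\vec j|},$$ where $\{Y_\nu^{|\vec n|-2|\vec j|}:1\le\nu\le\dim\mathbb H^d_{|\vec n|-2|\vec j|}\}$ is a basis of $\mathbb H^d_{|\vec n|-2|\vec j|}$. Denote a $d$-variate monomial by $\mathbf x^{\mathbf a}=x_1^{a_1}\cdots x_d^{a_d}$. Then $$\int_{\mathbb R^2}\mathbf P^{\vec n}_{\vec j,\nu}(\mathbf x)\,\mathbf x^{\mathbf a}\,W_l(\mathbf x)\,d\mathbf x=0\qquad\text{if }0\le|\mathbf a|<|\vec n|-2|\vec j|+2j_l,$$ for $1\le l\le r$ and $\nu=1,\dots,\dim\mathbb H^d_{|\vec n|-2|\vec j|}$.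
   Context: For a vector $v$ of nonnegative integers, $|v|$ is the sum of its components. $\mathbf x=(x_1,\dots,x_d)$ has spherical polar coordinates with radius $\rho=\|\mathbf x\|=\sqrt{x_1^2+\cdots+x_d^2}$. A weight function $W$ is radial if $W(\mathbf x)=\omega(\rho)=\omega(\sqrt{x_1^2+\cdots+x_d^2})$. The setting is that of radial weights supported on $\mathbb R^2$, while the notation is that of $d$ variables; the integral is over $\mathbb R^2$, so the displayed relation reads literally when $d=2$. $\mathbb H^d_M$ is the space of real homogeneous polynomials $P$ of degree $M$ in $d$ variables with $\Delta P=0$. For $k\ge0$ consider the system of weights $\rho^{k+1}\omega_1(\rho),\dots,\rho^{k+1}\omega_r(\rho)$ supported on $[0,+\infty)$. A multi-index $\vec v=(v_1,\dots,v_r)\in\mathbb N_0^r$ is normal for this system if both the Type I and the Type II multiple orthogonal polynomials exist. For normal $\vec v$, $p^{(k)}_{\vec v}$ denotes the associated Type II multiple orthogonal polynomial, a polynomial of degree $|\vec v|$ with $$\int_0^\infty p^{(k)}_{\vec v}(\rho)\,\rho^t\,\rho^{k+1}\omega_l(\rho)\,d\rho=0\qquad\text{if }0\le t<v_l,\quad 1\le l\le r,$$ and the Type I ones are polynomials $q^{(k)}_{\vec v,l}$, $1\le l\le r$, of degree at most $v_l-1$, with $\sum_{l=1}^r\int_0^\infty q^{(k)}_{\vec v,l}(\rho)\,\rho^t\,\rho^{k+1}\omega_l(\rho)\,d\rho=\delta_{t,|\vec v|-1}$ for $0\le t\le|\vec v|-1$. The multi-index $2\vec j$ is understood to be normal for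 the system with $k=2|\vec n|-4|\vec j|$. *)

theory Defs
  imports "HOL-Analysis.Analysis" "HOL-Computational_Algebra.Polynomial"
    "HOL-Library.Function_Algebras"
begin

definition mi_size :: "nat ^ 'n::finite \<Rightarrow> nat" where
  "mi_size v = (\<Sum>i\<in>UNIV. v $ i)"

definition mi_double :: "nat ^ 'n::finite \<Rightarrow> nat ^ 'n" where
  "mi_double v = (\<chi> i. 2 * v $ i)"

definition monomial_fun :: "nat ^ 'd::finite \<Rightarrow> real ^ 'd \<Rightarrow> real" where
  "monomial_fun a x = (\<Prod>i\<in>UNIV. (x $ i) ^ (a $ i))"

text \<open>Real polynomials in several variables are identified with the functions they induce.\<close>

definition homogeneous_poly_fun :: "nat \<Rightarrow> (real ^ 'd::finite \<Rightarrow> real) \<Rightarrow> bool" where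
  "homogeneous_poly_fun M f \<longleftrightarrow>
     (\<exists>c. \<forall>x. f x = (\<Sum>a | mi_size a = M. c a * monomial_fun a x))"

definition partial_deriv :: "'d::finite \<Rightarrow> (real ^ 'd \<Rightarrow> real) \<Rightarrow> real ^ 'd \<Rightarrow> real" where
  "partial_deriv i f x = deriv (\<lambda>t. f (x + t *\<^sub>R axis i 1)) 0"

definition laplacian :: "(real ^ 'd::finite \<Rightarrow> real) \<Rightarrow> real ^ 'd \<Rightarrow> real" where
  "laplacian f x = (\<Sum>i\<in>UNIV. partial_deriv i (partial_deriv i f) x)"

definition harmonic_space :: "nat \<Rightarrow> (real ^ 'd::finite \<Rightarrow> real) set" where
  "harmonic_space M = {f. homogeneous_poly_fun M f \<and> (\<forall>x. laplacian f x = 0)}"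

global_interpretation fun_space: vector_space "\<lambda>(c::real) (f::'a \<Rightarrow> real) x. c * f x"
  by unfold_locales (auto simp: fun_eq_iff algebra_simps)

definition is_basis_family :: "'i set \<Rightarrow> ('i \<Rightarrow> 'a \<Rightarrow> real) \<Rightarrow> ('a \<Rightarrow> real) set \<Rightarrow> bool" where
  "is_basis_family I Y V \<longleftrightarrow>
     inj_on Y I \<and> fun_space.independent (Y ` I) \<and> fun_space.span (Y ` I) = V"

text \<open>All moments are finite; the moment of order zero gives measurability.\<close>

definition weight_function :: "(real ^ 'd::finite \<Rightarrow> real) \<Rightarrow> bool" where
  "weight_function W \<longleftrightarrow>
     (\<forall>x. 0 \<le> W x) \<and> (\<forall>a. integrable lborel (\<lambda>x. monomial_fun a x * W x))"

definition radial_with_profile :: "(real \<Rightarrow> real) \<Rightarrow> (real ^ 'd::finite \<Rightarrow> real) \<Rightarrow> bool" where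
  "radial_with_profile \<omega> W \<longleftrightarrow> (\<forall>x. W x = \<omega> (norm x))"

text \<open>
  The system of weights is \<open>\<rho>\<^sup>k\<^sup>+\<^sup>1 \<omega>\<^sub>l(\<rho>)\<close> on \<open>[0, \<infinity>)\<close>. Type II polynomials are
  determined only up to a nonzero factor; no normalization is imposed.
\<close>

definition is_type_II ::
  "('r::finite \<Rightarrow> real \<Rightarrow> real) \<Rightarrow> nat \<Rightarrow> nat ^ 'r \<Rightarrow> real poly \<Rightarrow> bool" where
  "is_type_II \<omega> k v p \<longleftrightarrow>
     p \<noteq> 0 \<and> degree p = mi_size v \<and>
     (\<forall>l t. t < v $ l \<longrightarrow>
        (LINT \<rho>:{0..}|lborel. poly p \<rho> * \<rho> ^ t * (\<rho> ^ (k + 1) * \<omega> l \<rho>)) = 0)"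

text \<open>
  The disjunct \<open>q l = 0\<close> is the convention for degree at most \<open>v\<^sub>l - 1\<close> when \<open>v\<^sub>l = 0\<close>;
  \<open>t + 1 = |v|\<close> avoids truncated subtraction.
\<close>

definition is_type_I ::
  "('r::finite \<Rightarrow> real \<Rightarrow> real) \<Rightarrow> nat \<Rightarrow> nat ^ 'r \<Rightarrow> ('r \<Rightarrow> real poly) \<Rightarrow> bool" where
  "is_type_I \<omega> k v q \<longleftrightarrow>
     (\<forall>l. q l = 0 \<or> degree (q l) < v $ l) \<and>
     (\<forall>t < mi_size v.
        (\<Sum>l\<in>UNIV. LINT \<rho>:{0..}|lborel. poly (q l) \<rho> * \<rho> ^ t * (\<rho> ^ (k + 1) * \<omega> l \<rho>))
          = (if t + 1 = mi_size v then 1 else 0))"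

definition normal_index ::
  "('r::finite \<Rightarrow> real \<Rightarrow> real) \<Rightarrow> nat \<Rightarrow> nat ^ 'r \<Rightarrow> bool" where
  "normal_index \<omega> k v \<longleftrightarrow> (\<exists>q. is_type_I \<omega> k v q) \<and> (\<exists>p. is_type_II \<omega> k v p)"

end

theory Submission imports Defs begin

text \<open>
  With \<open>z = x\<^sub>1 + \<i> x\<^sub>2\<close>, a planar harmonic homogeneous polynomial of degree \<open>M\<close> is \<open>Re (\<gamma> z ^ M)\<close>,
  and a monomial is a combination of products \<open>z ^ b * cnj z ^ c\<close> with \<open>b + c = |a|\<close>. So the integral is
  a combination of integrals of \<open>F |x| * z ^ (M + b) * cnj z ^ c\<close>. If \<open>M + b \<noteq> c\<close>, a suitable rotation
  changes the sign of the integrand. If \<open>M + b = c\<close>, the integrand is radial and its integral is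
  \<open>2 \<pi>\<close> times that of \<open>\<rho> ^ (2 M + 1 + t) F \<rho>\<close> with \<open>t = |a| - M < 2 j\<^sub>l\<close>, which vanishes by the
  type II orthogonality. No polar coordinates are needed: the image of Lebesgue measure under the
  norm is read off from the areas of discs.
\<close>

section \<open>Multi-indices, monomials and the complex coordinate in the plane\<close>

lemma mi_size_2: "mi_size (a :: nat ^ 2) = a $ 1 + a $ 2"
  by (simp add: mi_size_def sum_2)

lemma monomial_fun_2: "monomial_fun a (x :: real ^ 2) = (x $ 1) ^ (a $ 1) * (x $ 2) ^ (a $ 2)"
  by (simp add: monomial_fun_def UNIV_2)

text \<open>In the complex coordinate a rotation is multiplication by \<open>cis\<close> of its
  angle, and planar harmonic polynomials are real parts of powers.\<close>

definition plane_complex :: "real ^ 2 \<Rightarrow> complex" where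
  "plane_complex x = Complex (x $ 1) (x $ 2)"

lemma norm_plane_complex [simp]: "norm (plane_complex x) = norm x"
  by (simp add: plane_complex_def norm_vec_def L2_set_def sum_2 cmod_def)

lemma continuous_plane_complex: "continuous_on UNIV plane_complex"
  unfolding plane_complex_def Complex_eq by (intro continuous_intros)

lemma measurable_plane_complex [measurable]: "plane_complex \<in> borel_measurable borel"
  by (rule borel_measurable_continuous_onI[OF continuous_plane_complex])

section \<open>Harmonic homogeneous polynomials in two variables\<close>

lemma homogeneous_poly_fun_2D:
  fixes f :: "real ^ 2 \<Rightarrow> real"
  assumes "homogeneous_poly_fun M f"
  obtains c where "f = (\<lambda>x. \<Sum>i\<le>M. c i * (x $ 1) ^ (M - i) * (x $ 2) ^ i)"
proof -
  obtain c where c: "\<And>x. f x = (\<Sum>a | mi_size a = M. c a * monomial_fun a x)"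
    using assms unfolding homogeneous_poly_fun_def by blast
  have "f x = (\<Sum>i\<le>M. c (vector [M - i, i]) * (x $ 1) ^ (M - i) * (x $ 2) ^ i)" for x
    unfolding c
  proof (rule sum.reindex_bij_witness[where i = "\<lambda>i. vector [M - i, i] :: nat ^ 2" and j = "\<lambda>a. a $ 2"])
    fix a :: "nat ^ 2"
    assume "a \<in> {a. mi_size a = M}"
    then have M: "M = a $ 1 + a $ 2" by (simp add: mi_size_2)
    then show vec: "vector [M - a $ 2, a $ 2] = a"
      by (simp add: vec_eq_iff forall_2)
    show "a $ 2 \<in> {..M}" using M by simp
    show "c (vector [M - a $ 2, a $ 2]) * (x $ 1) ^ (M - a $ 2) * (x $ 2) ^ (a $ 2) =
        c a * monomial_fun a x"
      unfolding vec by (simp add: M monomial_fun_2)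
  qed (auto simp: mi_size_2)
  then show ?thesis
    using that[of "\<lambda>i. c (vector [M - i, i])"] by blast
qed

text \<open>The exponents \<open>m\<close> and \<open>k\<close> are arbitrary so that the rule
  applies again to its own output. The truncated \<open>m i - 1\<close> is harmless: for
  \<open>m i = 0\<close> the factor \<open>real (m i)\<close> vanishes.\<close>

lemma partial_deriv_1_bivariate:
  "partial_deriv 1 (\<lambda>x :: real ^ 2. \<Sum>i\<in>A. c i * (x $ 1) ^ m i * (x $ 2) ^ k i) =
    (\<lambda>x. \<Sum>i\<in>A. (c i * real (m i)) * (x $ 1) ^ (m i - 1) * (x $ 2) ^ k i)"
  unfolding partial_deriv_def
  by (intro ext DERIV_imp_deriv)
     (auto intro!: derivative_eq_intros sum.cong simp: axis_def mult_ac)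

lemma partial_deriv_2_bivariate:
  "partial_deriv 2 (\<lambda>x :: real ^ 2. \<Sum>i\<in>A. c i * (x $ 1) ^ m i * (x $ 2) ^ k i) =
    (\<lambda>x. \<Sum>i\<in>A. (c i * real (k i)) * (x $ 1) ^ m i * (x $ 2) ^ (k i - 1))"
  unfolding partial_deriv_def
  by (intro ext DERIV_imp_deriv)
     (auto intro!: derivative_eq_intros sum.cong simp: axis_def mult_ac)

lemma binomial_shift_two:
  "Suc (Suc i) * Suc i * (n choose Suc (Suc i)) = (n - i) * (n - i - 1) * (n choose i)"
proof -
  have step: "Suc k * (n choose Suc k) = (n - k) * (n choose k)" for k
    by (metis binomial_absorb_comp binomial_absorption)
  have "Suc (Suc i) * Suc i * (n choose Suc (Suc i)) = Suc i * ((n - Suc i) * (n choose Suc i))"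
    by (subst step[symmetric]) (simp only: mult_ac)
  also have "\<dots> = (n - Suc i) * ((n - i) * (n choose i))"
    by (subst step[symmetric]) (simp only: mult_ac)
  finally show ?thesis by (simp add: mult_ac)
qed

text \<open>On the line where the first coordinate is 1 the Laplacian becomes a polynomial in the
  second one; it vanishes identically, hence so do its coefficients.\<close>

lemma harmonic_coeff_recurrence:
  fixes c :: "nat \<Rightarrow> real"
  assumes "\<And>x :: real ^ 2. laplacian (\<lambda>x. \<Sum>i\<le>M. c i * (x $ 1) ^ (M - i) * (x $ 2) ^ i) x = 0"
    and "i + 2 \<le> M"
  shows "c (i + 2) * (real (i + 2) * real (i + 1)) = - c i * (real (M - i) * real (M - i - 1))"
proof -
  define N where "N = M - 2"
  have M: "M = Suc (Suc N)" using assms(2) by (simp add: N_def)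
  have "(\<Sum>i\<le>N. (c i * (real (M - i) * real (M - i - 1)) + c (i + 2) * (real (i + 2) * real (i + 1))) * y ^ i) = 0"
    for y
  proof -
    have "0 = laplacian (\<lambda>x. \<Sum>i\<le>M. c i * (x $ 1) ^ (M - i) * (x $ 2) ^ i) (vector [1, y] :: real ^ 2)"
      by (simp only: assms(1))
    also have "\<dots> = (\<Sum>i\<le>M. c i * real (M - i) * real (M - i - 1) * y ^ i)
        + (\<Sum>i\<le>M. c i * real i * real (i - 1) * y ^ (i - 1 - 1))"
      by (simp add: laplacian_def sum_2 partial_deriv_1_bivariate partial_deriv_2_bivariate)
    \<comment> \<open>The two top terms vanish here; in the other sum the two bottom ones do, and
      the rest is shifted by two to match powers of \<open>y\<close>.\<close>
    also have "(\<Sum>i\<le>M. c i * real (M - i) * real (M - i - 1) * y ^ i) =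
        (\<Sum>i\<le>N. c i * real (M - i) * real (M - i - 1) * y ^ i)"
      by (simp add: M)
    also have "(\<Sum>i\<le>M. c i * real i * real (i - 1) * y ^ (i - 1 - 1)) =
        (\<Sum>i\<le>N. c (i + 2) * real (i + 2) * real (i + 1) * y ^ i)"
      unfolding M sum.atMost_Suc_shift by (simp del: sum.atMost_Suc)
    finally show ?thesis
      by (simp only: distrib_right sum.distrib mult.assoc)
  qed
  then have "c i * (real (M - i) * real (M - i - 1)) + c (i + 2) * (real (i + 2) * real (i + 1)) = 0"
    using polyfun_eq_0[of "\<lambda>i. c i * (real (M - i) * real (M - i - 1)) + c (i + 2) * (real (i + 2) * real (i + 1))" N]
      assms(2) by (simp add: M)
  then show ?thesis by linarith
qed

text \<open>Divided by binomial coefficients, the recurrence becomes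
  \<open>d (i + 2) = - d i\<close>, which the sequence \<open>Re (\<gamma> * \<i> ^ i)\<close>
  satisfies too. Matching two initial values therefore matches all, and the binomial theorem sums
  the result.\<close>

lemma harmonic_space_2D:
  fixes f :: "real ^ 2 \<Rightarrow> real"
  assumes "f \<in> harmonic_space M"
  obtains \<gamma> where "f = (\<lambda>x. Re (\<gamma> * plane_complex x ^ M))"
proof -
  have "homogeneous_poly_fun M f"
    using assms by (simp add: harmonic_space_def)
  then obtain c where f: "f = (\<lambda>x. \<Sum>i\<le>M. c i * (x $ 1) ^ (M - i) * (x $ 2) ^ i)"
    by (rule homogeneous_poly_fun_2D)
  have lap: "laplacian f x = 0" for x
    using assms by (simp add: harmonic_space_def)
  define d where "d i = c i / real (M choose i)" for i
  \<comment> \<open>Solves \<open>Re \<gamma> = d 0\<close> and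
    \<open>Re (\<gamma> * \<i>) = d 1\<close>; the latter real part is
    \<open>- Im \<gamma>\<close>.\<close>
  define \<gamma> where "\<gamma> = Complex (d 0) (- d 1)"
  have c: "c i = d i * real (M choose i)" if "i \<le> M" for i
    using that by (simp add: d_def)
  have d_step: "d (i + 2) = - d i" if "i + 2 \<le> M" for i
  proof -
    let ?b = "real ((M - i) * (M - i - 1) * (M choose i))"
    have "c (i + 2) * (real (i + 2) * real (i + 1)) = - c i * (real (M - i) * real (M - i - 1))"
      by (rule harmonic_coeff_recurrence[OF lap[unfolded f] that])
    moreover have "i \<le> M" using that by simp
    ultimately have "d (i + 2) * real ((i + 2) * (i + 1) * (M choose (i + 2))) = - d i * ?b"
      using that by (simp only: c of_nat_mult mult_minus_left mult_minus_right mult_ac)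
    moreover have "(i + 2) * (i + 1) * (M choose (i + 2)) = (M - i) * (M - i - 1) * (M choose i)"
      using binomial_shift_two[of i M] by simp
    ultimately have "d (i + 2) * ?b = - d i * ?b"
      by (simp only:)
    moreover have "?b \<noteq> 0" using that by simp
    ultimately show ?thesis by (metis mult_right_cancel)
  qed
  have d: "d i = Re (\<gamma> * \<i> ^ i)" if "i \<le> M" for i
    using that
  proof (induction i rule: induct_nat_012)
    case (ge2 i)
    then show ?case using d_step[of i] by simp
  qed (simp_all add: \<gamma>_def)
  have "f x = Re (\<gamma> * plane_complex x ^ M)" for x
  proof -
    have "plane_complex x = \<i> * of_real (x $ 2) + of_real (x $ 1)"
      by (simp add: plane_complex_def complex_eq_iff)
    then have "\<gamma> * plane_complex x ^ M =
        (\<Sum>i\<le>M. of_real (real (M choose i) * (x $ 1) ^ (M - i) * (x $ 2) ^ i) * (\<gamma> * \<i> ^ i))"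
      by (simp add: binomial_ring sum_distrib_left power_mult_distrib mult_ac)
    also have "Re \<dots> = (\<Sum>i\<le>M. real (M choose i) * (x $ 1) ^ (M - i) * (x $ 2) ^ i * Re (\<gamma> * \<i> ^ i))"
      by (simp only: Re_sum Re_complex_of_real Im_complex_of_real times_complex.sel) simp
    also have "\<dots> = f x"
      unfolding f by (intro sum.cong) (simp_all add: c d)
    finally show ?thesis by simp
  qed
  then show ?thesis using that by blast
qed

section \<open>Lebesgue measure under rotations and under the norm\<close>

lemma lborel_distr_orthogonal_transformation:
  fixes T :: "real ^ 'n::{finite,wellorder} \<Rightarrow> real ^ 'n::_"
  assumes T: "orthogonal_transformation T"
  shows "distr lborel borel T = lborel"
proof (rule lborel_eqI[symmetric])
  have lin: "linear T" using T by (rule orthogonal_transformation_linear)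
  then have "continuous_on UNIV T" by (simp add: linear_continuous_on linear_conv_bounded_linear)
  then have meas [measurable]: "T \<in> borel_measurable borel"
    by (rule borel_measurable_continuous_onI)
  fix l u :: "real ^ 'n::_"
  assume le: "\<And>b. b \<in> Basis \<Longrightarrow> l \<bullet> b \<le> u \<bullet> b"
  have bij: "bij T" using T by (rule orthogonal_transformation_bij)
  \<comment> \<open>Boxes determine the measure. As images under the orthogonal map
    \<open>inv T\<close>, their preimages keep their Lebesgue measure.\<close>
  have pre: "T -` box l u = inv T ` box l u"
    using bij by (rule bij_vimage_eq_inv_image)
  have invT: "orthogonal_transformation (inv T)"
    using T by (rule orthogonal_transformation_inv)
  have sets: "T -` box l u \<in> sets borel"
    using measurable_sets_borel[OF meas, of "box l u"] by simp
  have lm: "T -` box l u \<in> lmeasurable"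
    unfolding pre by (rule measurable_orthogonal_image[OF invT]) simp
  have "emeasure lborel (T -` box l u) = emeasure lebesgue (T -` box l u)"
    using sets by simp
  also have "\<dots> = measure lebesgue (T -` box l u)"
    using lm by (simp add: emeasure_eq_measure2)
  also have "\<dots> = measure lebesgue (box l u)"
    unfolding pre by (subst measure_orthogonal_image[OF invT]) simp_all
  also have "\<dots> = (\<Prod>b\<in>Basis. (u - l) \<bullet> b)"
    using measure_lborel_box[of l u] le by simp
  finally show "emeasure (distr lborel borel T) (box l u) = (\<Prod>b\<in>Basis. (u - l) \<bullet> b)"
    by (simp add: emeasure_distr)
qed simp

text \<open>The half-lines \<open>{..a}\<close> are an intersection-stable generator, and both
  measures give \<open>{..a}\<close> the area of the disc of radius \<open>a\<close>; the density
  \<open>2 * pi * r\<close> is the derivative of that area.\<close>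

lemma distr_norm_lborel_2:
  "distr (lborel :: (real ^ 2) measure) borel norm =
    density lborel (\<lambda>r. ennreal (2 * pi * r * indicator {0..} r))" (is "?M = ?N")
proof (rule measure_eqI_generator_eq)
  let ?E = "range (\<lambda>a::real. {..a})"
  show "Int_stable ?E" by (auto simp: Int_stable_def)
  show "?E \<subseteq> Pow UNIV" by simp
  show "sets ?M = sigma_sets UNIV ?E" "sets ?N = sigma_sets UNIV ?E"
    by (simp_all add: borel_eq_atMost)
  have M: "emeasure ?M {..a} = (if a < 0 then 0 else ennreal (pi * a\<^sup>2))" for a
  proof -
    have "norm -` {..a} = cball (0 :: real ^ 2) a" by (auto simp: dist_norm)
    then have "emeasure ?M {..a} = emeasure lborel (cball (0 :: real ^ 2) a)"
      by (subst emeasure_distr) simp_all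
    then show ?thesis by (simp add: emeasure_cball unit_ball_vol_2)
  qed
  have N: "emeasure ?N {..a} = (if a < 0 then 0 else ennreal (pi * a\<^sup>2))" for a
  proof -
    have "emeasure ?N {..a} = (\<integral>\<^sup>+r. ennreal (2 * pi * r) * indicator {0..a} r \<partial>lborel)"
      by (subst emeasure_density) (auto intro!: nn_integral_cong simp: indicator_def)
    also have "\<dots> = (if a < 0 then 0 else ennreal (pi * a\<^sup>2))"
    proof (cases "a < 0")
      case False
      have "(\<integral>\<^sup>+r. ennreal (2 * pi * r) * indicator {0..a} r \<partial>lborel) = pi * a\<^sup>2 - pi * 0\<^sup>2"
        using False by (intro nn_integral_FTC_Icc) (auto intro!: derivative_eq_intros)
      then show ?thesis using False by simp
    qed simp
    finally show ?thesis .
  qed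
  show "emeasure ?M X = emeasure ?N X" if "X \<in> ?E" for X
    using that M N by auto
  show "range (\<lambda>i::nat. {..real i}) \<subseteq> ?E" by auto
  show "(\<Union>i. {..real i}) = UNIV"
    using real_arch_simple by auto
  show "emeasure ?M {..real i} \<noteq> \<infinity>" for i by (simp add: M)
qed

lemma integral_radial_2:
  fixes g :: "real \<Rightarrow> real"
  assumes "(\<lambda>x :: real ^ 2. g (norm x)) \<in> borel_measurable borel"
  shows "(LINT x|(lborel :: (real ^ 2) measure). g (norm x)) = 2 * pi * (LINT r:{0..}|lborel. r * g r)"
proof -
  \<comment> \<open>Only the composition of \<open>g\<close> with the norm is known to be
    measurable, so \<open>g\<close> may be wild on negative numbers. Its even extension
    \<open>h\<close> is measurable, being that composition restricted to a coordinate axis.\<close>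
  define h where "h r = g \<bar>r\<bar>" for r
  have "(\<lambda>r. g (norm (r *\<^sub>R axis 1 1 :: real ^ 2))) \<in> borel_measurable borel"
    by (rule measurable_compose[OF _ assms]) simp
  then have [measurable]: "h \<in> borel_measurable borel"
    by (simp add: h_def[abs_def])
  have "(LINT x|(lborel :: (real ^ 2) measure). g (norm x)) = (LINT x|(lborel :: (real ^ 2) measure). h (norm x))"
    by (simp add: h_def)
  also have "\<dots> = (LINT r|distr (lborel :: (real ^ 2) measure) borel norm. h r)"
    by (subst integral_distr) simp_all
  also have "\<dots> = (LINT r|lborel. (2 * pi * r * indicator {0..} r) *\<^sub>R h r)"
    unfolding distr_norm_lborel_2 by (rule integral_density) (auto simp: indicator_def)
  also have "\<dots> = (LINT r|lborel. 2 * pi * (indicator {0..} r *\<^sub>R (r * g r)))"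
    by (intro Bochner_Integration.integral_cong) (auto simp: h_def indicator_def)
  finally show ?thesis
    by (simp add: set_lebesgue_integral_def)
qed

section \<open>Integrals of radial functions against powers of z and its conjugate\<close>

lemma integral_radial_angular_zero:
  fixes F :: "real \<Rightarrow> real"
  assumes [measurable]: "(\<lambda>x :: real ^ 2. F (norm x)) \<in> borel_measurable borel"
    and "B \<noteq> C"
  shows "(LINT x|lborel. of_real (F (norm x)) * plane_complex x ^ B * cnj (plane_complex x) ^ C) = 0"
proof -
  \<comment> \<open>The rotation \<open>T\<close> by \<open>\<phi>\<close> multiplies the integrand
    by \<open>cis ((real B - real C) * \<phi>)\<close>; this angle makes the factor
    \<open>cis pi = -1\<close>. The difference is taken in the reals because \<open>B < C\<close>
    may occur.\<close>
  define \<phi> where "\<phi> = pi / (real B - real C)"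
  define T :: "real ^ 2 \<Rightarrow> real ^ 2" where
    "T x = vector [cos \<phi> * x $ 1 - sin \<phi> * x $ 2, sin \<phi> * x $ 1 + cos \<phi> * x $ 2]" for x
  define G where "G x = of_real (F (norm x)) * plane_complex x ^ B * cnj (plane_complex x) ^ C" for x
  have z: "plane_complex (T x) = cis \<phi> * plane_complex x" for x
    by (simp add: plane_complex_def T_def complex_eq_iff)
  have norm: "norm (T x) = norm x" for x
    using arg_cong[OF z[of x], of norm] by (simp add: norm_mult)
  have "linear T"
    by (rule linearI) (simp_all add: T_def vec_eq_iff forall_2 algebra_simps)
  then have T: "orthogonal_transformation T"
    by (simp add: orthogonal_transformation norm)
  have [measurable]: "T \<in> borel_measurable borel"
    by (rule borel_measurable_continuous_onI)
       (simp add: linear_continuous_on \<open>linear T\<close> flip: linear_conv_bounded_linear)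
  have [measurable]: "cnj \<in> borel_measurable borel"
    by (intro borel_measurable_continuous_onI continuous_intros)
  have G [measurable]: "G \<in> borel_measurable borel"
    unfolding G_def by measurable
  have "cis \<phi> ^ B * cis (- \<phi>) ^ C = cis ((real B - real C) * \<phi>)"
    by (simp add: Complex.DeMoivre cis_mult algebra_simps)
  also have "\<dots> = -1"
    using \<open>B \<noteq> C\<close> by (simp add: \<phi>_def)
  finally have u: "cis \<phi> ^ B * cis (- \<phi>) ^ C = -1" .
  have GT: "G (T x) = - G x" for x
  proof -
    have "G (T x) = (cis \<phi> ^ B * cis (- \<phi>) ^ C) * G x"
      by (simp add: G_def z norm power_mult_distrib mult_ac cis_cnj)
    then show ?thesis by (simp add: u)
  qed
  have "integral\<^sup>L lborel G = integral\<^sup>L (distr lborel borel T) G"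
    by (simp add: lborel_distr_orthogonal_transformation[OF T])
  also have "\<dots> = - integral\<^sup>L lborel G"
    by (subst integral_distr) (simp_all add: GT)
  finally show ?thesis unfolding G_def by simp
qed

text \<open>Each coordinate is at most \<open>norm x\<close> in absolute value, so a single radial
  moment of order \<open>a + b + B + C\<close> dominates.\<close>

lemma integrable_radial_moment:
  fixes F :: "real \<Rightarrow> real"
  assumes [measurable]: "(\<lambda>x :: real ^ 2. F (norm x)) \<in> borel_measurable borel"
    and int: "\<And>m. integrable lborel (\<lambda>x :: real ^ 2. norm x ^ m * F (norm x))"
  shows "integrable lborel (\<lambda>x :: real ^ 2. of_real (F (norm x) * (x $ 1) ^ a * (x $ 2) ^ b)
            * plane_complex x ^ B * cnj (plane_complex x) ^ C)"
proof (rule Bochner_Integration.integrable_bound[OF int[of "a + b + B + C"]])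
  have [measurable]: "cnj \<in> borel_measurable borel"
    by (intro borel_measurable_continuous_onI continuous_intros)
  show "(\<lambda>x :: real ^ 2. of_real (F (norm x) * (x $ 1) ^ a * (x $ 2) ^ b)
            * plane_complex x ^ B * cnj (plane_complex x) ^ C) \<in> borel_measurable lborel"
    by measurable
  have "\<bar>F (norm x)\<bar> * \<bar>x $ 1\<bar> ^ a * \<bar>x $ 2\<bar> ^ b * norm x ^ B * norm x ^ C
      \<le> \<bar>F (norm x)\<bar> * norm x ^ a * norm x ^ b * norm x ^ B * norm x ^ C" for x :: "real ^ 2"
    by (intro mult_mono power_mono component_le_norm_cart) auto
  then show "AE x in lborel. norm (of_real (F (norm x) * (x $ 1) ^ a * (x $ 2) ^ b)
      * plane_complex x ^ B * cnj (plane_complex x) ^ C) \<le> norm (norm x ^ (a + b + B + C) * F (norm x))"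
    by (intro AE_I2) (simp add: norm_mult norm_power abs_mult power_abs power_add mult_ac)
qed

text \<open>Keeping the exponents of \<open>x\<^sub>1\<close>, \<open>x\<^sub>2\<close>, \<open>z\<close> and \<open>cnj z\<close> separate lets the induction trade a
  factor \<open>x\<^sub>1\<close> or \<open>x\<^sub>2\<close> for \<open>z\<close> or \<open>cnj z\<close> while preserving the hypotheses on \<open>B\<close> and on the total
  degree. The radial hypothesis is needed only when \<open>a = b = 0\<close> and \<open>B = C\<close>.\<close>

lemma radial_moment_zero:
  fixes F :: "real \<Rightarrow> real"
  assumes meas: "(\<lambda>x :: real ^ 2. F (norm x)) \<in> borel_measurable borel"
    and int: "\<And>m. integrable lborel (\<lambda>x :: real ^ 2. norm x ^ m * F (norm x))"
    and orth: "\<And>t. t < K \<Longrightarrow> (LINT r:{0..}|lborel. r ^ (2 * M + t + 1) * F r) = 0"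
    and "M \<le> B" "a + b + B + C < 2 * M + K"
  shows "(LINT x|(lborel :: (real ^ 2) measure). of_real (F (norm x) * (x $ 1) ^ a * (x $ 2) ^ b)
            * plane_complex x ^ B * cnj (plane_complex x) ^ C) = 0"
proof -
  define J where "J a b B C x = of_real (F (norm x) * (x $ 1) ^ a * (x $ 2) ^ b)
            * plane_complex x ^ B * cnj (plane_complex x) ^ C" for a b B C and x :: "real ^ 2"
  \<comment> \<open>Integrability of every \<open>J\<close> is what allows the integrals of the sums
    in \<open>step1\<close> and \<open>step2\<close> to be split.\<close>
  have J_int: "integrable lborel (J a b B C)" for a b B C
    unfolding J_def by (rule integrable_radial_moment[OF meas int])
  have x1: "of_real (x $ 1) = (plane_complex x + cnj (plane_complex x)) / 2"
    and x2: "of_real (x $ 2) = (plane_complex x - cnj (plane_complex x)) / (2 * \<i>)" for x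
    by (simp_all add: plane_complex_def complex_eq_iff Re_divide Im_divide)
  have step1: "J (Suc a) b B C = (\<lambda>x. (1/2) * J a b (Suc B) C x + (1/2) * J a b B (Suc C) x)"
    for a b B C
  proof
    fix x
    have "J (Suc a) b B C x = of_real (x $ 1) * J a b B C x"
      by (simp add: J_def)
    then show "J (Suc a) b B C x = (1/2) * J a b (Suc B) C x + (1/2) * J a b B (Suc C) x"
      by (simp add: x1 J_def algebra_simps)
  qed
  have step2: "J a (Suc b) B C = (\<lambda>x. (1/(2*\<i>)) * J a b (Suc B) C x - (1/(2*\<i>)) * J a b B (Suc C) x)"
    for a b B C
  proof
    fix x
    have "J a (Suc b) B C x = of_real (x $ 2) * J a b B C x"
      by (simp add: J_def)
    then show "J a (Suc b) B C x = (1/(2*\<i>)) * J a b (Suc B) C x - (1/(2*\<i>)) * J a b B (Suc C) x"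
      by (simp add: x2 J_def algebra_simps diff_divide_distrib)
  qed
  have "integral\<^sup>L lborel (J a b B C) = 0"
    using assms(4,5)
  proof (induction a arbitrary: B C)
    case 0
    then show ?case
    proof (induction b arbitrary: B C)
      case 0
      show ?case
      proof (cases "B = C")
        case False
        then show ?thesis
          using integral_radial_angular_zero[OF meas] by (simp add: J_def)
      next
        case True
        \<comment> \<open>The subtraction does not truncate since \<open>M \<le> B\<close>, and
          \<open>t < K\<close> because the total degree is now \<open>B + C = 2 * B\<close>.\<close>
        define t where "t = 2 * B - 2 * M"
        have t: "2 * B = 2 * M + t" "t < K"
          using 0 True by (auto simp: t_def)
        have "J 0 0 B C = (\<lambda>x. of_real (norm x ^ (2 * B) * F (norm x)))"
        proof
          fix x
          have "plane_complex x ^ B * cnj (plane_complex x) ^ B = of_real (norm x ^ (2 * B))"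
            by (simp add: complex_norm_square[symmetric] power_mult flip: power_mult_distrib)
          then show "J 0 0 B C x = of_real (norm x ^ (2 * B) * F (norm x))"
            by (simp add: J_def True mult_ac)
        qed
        then have "integral\<^sup>L lborel (J 0 0 B C) =
            of_real (LINT x|(lborel :: (real ^ 2) measure). norm x ^ (2 * B) * F (norm x))"
          by (simp only: integral_complex_of_real)
        also have "(LINT x|(lborel :: (real ^ 2) measure). norm x ^ (2 * B) * F (norm x)) =
            2 * pi * (LINT r:{0..}|lborel. r * (r ^ (2 * B) * F r))"
          by (rule integral_radial_2) (use meas in measurable)
        \<comment> \<open>The factor \<open>r\<close> from the area element accounts for the
          \<open>+ 1\<close> in the exponent of the orthogonality relation.\<close>
        also have "(\<lambda>r. r * (r ^ (2 * B) * F r)) = (\<lambda>r. r ^ (2 * M + t + 1) * F r)"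
          unfolding t(1) by (simp add: fun_eq_iff mult_ac)
        also have "2 * pi * (LINT r:{0..}|lborel. r ^ (2 * M + t + 1) * F r) = 0"
          unfolding orth[OF t(2)] by simp
        finally show ?thesis by simp
      qed
    next
      case (Suc b)
      then show ?case by (simp add: step2 J_int)
    qed
  next
    case (Suc a)
    then show ?case by (simp add: step1 J_int)
  qed
  then show ?thesis by (simp only: J_def[abs_def])
qed

section \<open>Moments of the weights and the orthogonality relation\<close>

lemma weight_function_measurable:
  assumes "weight_function W"
  shows "W \<in> borel_measurable borel"
proof -
  have "integrable lborel (\<lambda>x. monomial_fun 0 x * W x)"
    using assms unfolding weight_function_def by blast
  then show ?thesis by (simp add: monomial_fun_def)
qed

text \<open>Odd powers of the norm are not polynomials, so they are dominated by the pure powers of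
  the two coordinates, whose moments are finite.\<close>

lemma integrable_norm_power_weight:
  fixes W :: "real ^ 2 \<Rightarrow> real"
  assumes "weight_function W"
  shows "integrable lborel (\<lambda>x. norm x ^ m * W x)"
proof -
  have [measurable]: "W \<in> borel_measurable borel"
    using assms by (rule weight_function_measurable)
  have W: "0 \<le> W x" for x using assms by (simp add: weight_function_def)
  have "integrable lborel (\<lambda>x. monomial_fun a x * W x)" for a
    using assms unfolding weight_function_def by blast
  from this[of "vector [m, 0]"] this[of "vector [0, m]"]
  have "integrable lborel (\<lambda>x. 2 ^ m * (\<bar>(x $ 1) ^ m * W x\<bar> + \<bar>(x $ 2) ^ m * W x\<bar>))"
    by (simp add: monomial_fun_2)
  then show ?thesis
  proof (rule Bochner_Integration.integrable_bound)
    have "norm x ^ m * W x \<le> 2 ^ m * (\<bar>x $ 1\<bar> ^ m + \<bar>x $ 2\<bar> ^ m) * W x" for x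
    proof (rule mult_right_mono[OF _ W])
      have "norm x \<le> \<bar>x $ 1\<bar> + \<bar>x $ 2\<bar>"
        using norm_le_l1_cart[of x] by (simp add: sum_2)
      \<comment> \<open>Passing to the maximum yields the factor \<open>2 ^ m\<close>: the power of
        a maximum is one of the two powers, hence at most their sum.\<close>
      also have "\<dots> \<le> 2 * max \<bar>x $ 1\<bar> \<bar>x $ 2\<bar>" by simp
      finally have "norm x ^ m \<le> (2 * max \<bar>x $ 1\<bar> \<bar>x $ 2\<bar>) ^ m"
        by (intro power_mono) auto
      also have "\<dots> \<le> 2 ^ m * (\<bar>x $ 1\<bar> ^ m + \<bar>x $ 2\<bar> ^ m)"
        by (auto simp: power_mult_distrib max_def)
      finally show "norm x ^ m \<le> 2 ^ m * (\<bar>x $ 1\<bar> ^ m + \<bar>x $ 2\<bar> ^ m)" .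
    qed
    then show "AE x in lborel. norm (norm x ^ m * W x) \<le>
        norm (2 ^ m * (\<bar>(x $ 1) ^ m * W x\<bar> + \<bar>(x $ 2) ^ m * W x\<bar>))"
      by (intro AE_I2) (simp add: abs_mult W power_abs algebra_simps)
  qed measurable
qed

theorem proposition22:
  fixes W :: "'r::finite \<Rightarrow> real ^ 2 \<Rightarrow> real"
    and \<omega> :: "'r \<Rightarrow> real \<Rightarrow> real"
    and n j :: "nat ^ 'r"
    and p :: "real poly"
    and Y :: "nat \<Rightarrow> real ^ 2 \<Rightarrow> real"
  assumes "\<And>l. weight_function (W l)"
    and "\<And>l. radial_with_profile (\<omega> l) (W l)"
    and "2 * mi_size j \<le> mi_size n"
    and "normal_index \<omega> (2 * mi_size n - 4 * mi_size j) (mi_double j)"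
    and "is_type_II \<omega> (2 * mi_size n - 4 * mi_size j) (mi_double j) p"
    and "is_basis_family
           {1..fun_space.dim (harmonic_space (mi_size n - 2 * mi_size j) :: (real ^ 2 \<Rightarrow> real) set)}
           Y (harmonic_space (mi_size n - 2 * mi_size j))"
  shows "\<forall>l. \<forall>\<nu> \<in> {1..fun_space.dim (harmonic_space (mi_size n - 2 * mi_size j) :: (real ^ 2 \<Rightarrow> real) set)}.
           \<forall>a :: nat ^ 2. mi_size a < mi_size n - 2 * mi_size j + 2 * j $ l \<longrightarrow>
             (LINT x|lborel. (poly p (norm x) * Y \<nu> x) * monomial_fun a x * W l x) = 0"
proof (intro allI ballI impI)
  fix l \<nu> and a :: "nat ^ 2"
  define M where "M = mi_size n - 2 * mi_size j"
  assume \<nu>: "\<nu> \<in> {1..fun_space.dim (harmonic_space (mi_size n - 2 * mi_size j) :: (real ^ 2 \<Rightarrow> real) set)}"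
    and "mi_size a < mi_size n - 2 * mi_size j + 2 * j $ l"
  then have a: "a $ 1 + a $ 2 < M + 2 * j $ l"
    by (simp add: M_def mi_size_2)
  have "Y \<nu> \<in> harmonic_space M"
    using assms(6) \<nu> unfolding is_basis_family_def M_def by (metis fun_space.span_base imageI)
  then obtain \<gamma> where Y: "Y \<nu> = (\<lambda>x. Re (\<gamma> * plane_complex x ^ M))"
    by (rule harmonic_space_2D)
  have W: "W l x = \<omega> l (norm x)" for x
    using assms(2) by (simp add: radial_with_profile_def)
  \<comment> \<open>Absorbing \<open>p\<close> into the radial factor turns its type II
    orthogonality into the one-dimensional condition of \<open>radial_moment_zero\<close>.\<close>
  define F where "F r = poly p r * \<omega> l r" for r
  have F: "F (norm x) = poly p (norm x) * W l x" for x by (simp add: F_def W)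
  have [measurable]: "W l \<in> borel_measurable borel"
    by (rule weight_function_measurable) (rule assms(1))
  have [measurable]: "poly p \<in> borel_measurable borel"
    by (intro borel_measurable_continuous_onI continuous_on_poly continuous_on_id)
  have meas: "(\<lambda>x :: real ^ 2. F (norm x)) \<in> borel_measurable borel"
    unfolding F by measurable
  have int: "integrable lborel (\<lambda>x :: real ^ 2. norm x ^ m * F (norm x))" for m
  proof -
    \<comment> \<open>Expanding \<open>p\<close> reduces the moments of \<open>F\<close> to moments
      of the weight itself.\<close>
    have "(\<lambda>x :: real ^ 2. norm x ^ m * F (norm x)) =
        (\<lambda>x. \<Sum>i\<le>degree p. coeff p i * (norm x ^ (m + i) * W l x))"
      by (simp add: F poly_altdef power_add sum_distrib_left sum_distrib_right mult_ac)
    then show ?thesis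
      by (simp only:) (intro Bochner_Integration.integrable_sum integrable_mult_right
          integrable_norm_power_weight assms(1))
  qed
  have orth: "(LINT r:{0..}|lborel. r ^ (2 * M + t + 1) * F r) = 0" if "t < 2 * j $ l" for t
  proof -
    have k: "2 * mi_size n - 4 * mi_size j = 2 * M" by (simp add: M_def)
    have "(LINT r:{0..}|lborel. poly p r * r ^ t * (r ^ (2 * M + 1) * \<omega> l r)) = 0"
      using assms(5) that unfolding is_type_II_def k by (simp add: mi_double_def)
    then show ?thesis by (simp add: F_def power_add mult_ac)
  qed
  let ?J = "\<lambda>x. of_real (F (norm x) * (x $ 1) ^ (a $ 1) * (x $ 2) ^ (a $ 2))
            * plane_complex x ^ M * cnj (plane_complex x) ^ 0"
  have "(poly p (norm x) * Y \<nu> x) * monomial_fun a x * W l x = Re (\<gamma> * ?J x)" for x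
  proof -
    have "Re (\<gamma> * ?J x) =
        Re (of_real (F (norm x) * (x $ 1) ^ (a $ 1) * (x $ 2) ^ (a $ 2)) * (\<gamma> * plane_complex x ^ M))"
      by (simp only: power_0 complex_cnj_one mult_1_right mult_1_left mult_ac)
    also have "\<dots> = F (norm x) * (x $ 1) ^ (a $ 1) * (x $ 2) ^ (a $ 2) * Y \<nu> x"
      by (simp only: Y times_complex.sel Re_complex_of_real Im_complex_of_real mult_zero_left diff_zero)
    finally show ?thesis by (simp add: F monomial_fun_2 mult_ac)
  qed
  then have "(LINT x|lborel. (poly p (norm x) * Y \<nu> x) * monomial_fun a x * W l x) =
      (LINT x|lborel. Re (\<gamma> * ?J x))"
    by simp
  also have "\<dots> = Re (LINT x|lborel. \<gamma> * ?J x)"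
    by (rule integral_Re) (intro integrable_mult_right integrable_radial_moment[OF meas int])
  also have "(LINT x|lborel. \<gamma> * ?J x) = \<gamma> * (LINT x|lborel. ?J x)"
    by (rule integral_mult_right_zero)
  \<comment> \<open>With \<open>B = M\<close>, \<open>C = 0\<close> and
    \<open>K = 2 * j $ l\<close>, the degree bound \<open>a $ 1 + a $ 2 + M < 2 * M + K\<close> is
    exactly the assumption on \<open>a\<close>.\<close>
  also have "(LINT x|lborel. ?J x) = 0"
    using a by (intro radial_moment_zero[OF meas int orth]) auto
  finally show "(LINT x|lborel. (poly p (norm x) * Y \<nu> x) * monomial_fun a x * W l x) = 0"
    by simp
qed

end
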